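(* Let $A$ be a $C^*$-algebra and let $M$ be a pre-Hilbert $A$-module. Every orthogonal system of $M$ can be enlarged to a complete orthogonal system of $M$; that is, for every orthogonal system $\{e_i\}_{i\in I}$ of $M$ there are a set $J\supseteq I$ and a complete orthogonal system $\{e_j\}_{j\in J}$ of $M$ extending it. Also, every orthogonal system of norm one vectors of $M$ can be enlarged to a complete orthogonal system of norm one vectors of $M$.
   Context: A pre-Hilbert $A$-module is a right $A$-module $M$ (compatibly a complex vector space) with an $A$-valued inner product $\langle\cdot,\cdot\rangle$ that is linear in the second variable and satisfies $\langle x,ya\rangle=\langle x,y\rangle a$, $\langle x,y\rangle^*=\langle y,x\rangle$, $\langle x,x\rangle\ge 0$, and $\langle x,x\rangle=0$ only if $x=0$. Its norm is $\|x\|=\|\langle x,x\rangle\|^{1/2}$; completeness of $M$ in this norm is not assumed. A collection $\{e_i\}_{i\in I}$ of vectors of $M$, indexed by some set $I$, is called an orthogonal system if $\langle e_i,e_j\rangle=0$ whenever $i\neq j$. An orthogonal system $\{e_i\}_{i\in I}$ is complete if there is no non-zero vector $x\in M$ such that $\langle e_i,x\rangle=0$ for all $i\in I$. *)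

theory Defs
  imports Complex_Main
begin

class complex_vector = ab_group_add +
  fixes scaleC :: "complex \<Rightarrow> 'a \<Rightarrow> 'a"  (infixr "*\<^sub>C" 75)
  assumes scaleC_add_right: "c *\<^sub>C (x + y) = c *\<^sub>C x + c *\<^sub>C y"
    and scaleC_add_left: "(c + d) *\<^sub>C x = c *\<^sub>C x + d *\<^sub>C x"
    and scaleC_scaleC: "c *\<^sub>C d *\<^sub>C x = (c * d) *\<^sub>C x"
    and scaleC_one: "1 *\<^sub>C x = x"

global_interpretation complex_vector: vector_space "scaleC :: complex \<Rightarrow> 'a \<Rightarrow> 'a :: complex_vector"
  by standard (rule scaleC_add_right scaleC_add_left scaleC_scaleC scaleC_one)+

text \<open>No unit is assumed. Completeness comes from \<^class>\<open>banach\<close> and submultiplicativity of the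
  norm from \<^class>\<open>real_normed_algebra\<close>.\<close>

class cstar_algebra = complex_vector + banach + real_normed_algebra +
  fixes star :: "'a \<Rightarrow> 'a"
  assumes scaleC_of_real: "complex_of_real r *\<^sub>C a = r *\<^sub>R a"
    and norm_scaleC: "norm (c *\<^sub>C a) = cmod c * norm a"
    and scaleC_mult_left: "(c *\<^sub>C a) * b = c *\<^sub>C (a * b)"
    and scaleC_mult_right: "a * (c *\<^sub>C b) = c *\<^sub>C (a * b)"
    and star_star: "star (star a) = a"
    and star_add: "star (a + b) = star a + star b"
    and star_scaleC: "star (c *\<^sub>C a) = cnj c *\<^sub>C star a"
    and star_mult: "star (a * b) = star b * star a"
    and cstar_identity: "norm (star a * a) = (norm a)\<^sup>2"

text \<open>Without a unit the spectrum would have to be taken in the unitization; positivity is therefore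
  given by the form \<open>b\<^sup>* b\<close>.\<close>

definition cstar_nonneg :: "'a :: cstar_algebra \<Rightarrow> bool" where
  "cstar_nonneg a \<longleftrightarrow> (\<exists>b. a = star b * b)"

locale pre_hilbert_module =
  fixes act :: "'m :: complex_vector \<Rightarrow> 'a :: cstar_algebra \<Rightarrow> 'm"
    and ip :: "'m \<Rightarrow> 'm \<Rightarrow> 'a"
  assumes act_add_left: "act (x + y) a = act x a + act y a"
    and act_add_right: "act x (a + b) = act x a + act x b"
    and act_act: "act (act x a) b = act x (a * b)"
    and act_scaleC_left: "act (c *\<^sub>C x) a = c *\<^sub>C act x a"
    and act_scaleC_right: "act x (c *\<^sub>C a) = c *\<^sub>C act x a"
    and ip_add_right: "ip x (y + z) = ip x y + ip x z"
    and ip_scaleC_right: "ip x (c *\<^sub>C y) = c *\<^sub>C ip x y"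
    and ip_act_right: "ip x (act y a) = ip x y * a"
    and star_ip: "star (ip x y) = ip y x"
    and ip_self_nonneg: "cstar_nonneg (ip x x)"
    and ip_self_zero: "ip x x = 0 \<Longrightarrow> x = 0"

definition module_norm :: "('m \<Rightarrow> 'm \<Rightarrow> 'a :: cstar_algebra) \<Rightarrow> 'm \<Rightarrow> real" where
  "module_norm ip x = sqrt (norm (ip x x))"

definition orthogonal_system ::
    "('m \<Rightarrow> 'm \<Rightarrow> 'a :: cstar_algebra) \<Rightarrow> 'i set \<Rightarrow> ('i \<Rightarrow> 'm) \<Rightarrow> bool" where
  "orthogonal_system ip I e \<longleftrightarrow> (\<forall>i\<in>I. \<forall>j\<in>I. i \<noteq> j \<longrightarrow> ip (e i) (e j) = 0)"

definition complete_orthogonal_system ::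
    "('m :: zero \<Rightarrow> 'm \<Rightarrow> 'a :: cstar_algebra) \<Rightarrow> 'i set \<Rightarrow> ('i \<Rightarrow> 'm) \<Rightarrow> bool" where
  "complete_orthogonal_system ip I e \<longleftrightarrow>
     orthogonal_system ip I e \<and> \<not> (\<exists>x. x \<noteq> 0 \<and> (\<forall>i\<in>I. ip (e i) x = 0))"

text \<open>The index type \<^typ>\<open>'i\<close> may have no elements outside \<open>I\<close>, so the larger index set \<open>J\<close> lives in
  \<^typ>\<open>'i + 'm\<close>, with \<open>I\<close> identified with its copy \<open>Inl ` I\<close>: adjoined vectors
  can be indexed by themselves.\<close>

definition enlarges_system ::
    "('i + 'm) set \<Rightarrow> ('i + 'm \<Rightarrow> 'm) \<Rightarrow> 'i set \<Rightarrow> ('i \<Rightarrow> 'm) \<Rightarrow> bool" where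
  "enlarges_system J f I e \<longleftrightarrow> Inl ` I \<subseteq> J \<and> (\<forall>i\<in>I. f (Inl i) = e i)"

end

theory Submission
  imports Defs
begin

text \<open>
  This is the Hilbert space argument: among all sets of pairwise orthogonal unit vectors that are
  also orthogonal to the given system, Zorn's lemma provides a maximal one. A non-zero vector
  orthogonal to everything could be rescaled by a complex number to a unit vector and adjoined,
  contradicting maximality, so the enlarged system is complete.

  One construction serves both claims: since the adjoined vectors always have norm one
  (\<open>enlarge_by_unit_vectors\<close>), the enlarged system consists of norm one vectors as soon as the
  original one does. The rescaling (\<open>module_norm_normalize\<close>) makes the norm of \<open>ip x x\<close> equal to one,
  not \<open>ip x x\<close> itself: that element of \<open>A\<close> may well fail to be invertible, and then there is no
  dividing by its square root.
\<close>

lemma star_zero: "star (0 :: 'a :: cstar_algebra) = 0"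
  using star_add[of 0 "0 :: 'a"] by simp

text \<open>
  Zorn's lemma applies because the condition involves only two elements at a time, and any two
  elements of the union of a chain lie in a common member of the chain.
\<close>

lemma exists_maximal_pairwise:
  obtains S where "S \<subseteq> U" "pairwise R S"
    "\<And>T. T \<subseteq> U \<Longrightarrow> pairwise R T \<Longrightarrow> S \<subseteq> T \<Longrightarrow> T = S"
proof -
  have "\<exists>S\<in>{S. S \<subseteq> U \<and> pairwise R S}. \<forall>T\<in>{S. S \<subseteq> U \<and> pairwise R S}. S \<subseteq> T \<longrightarrow> T = S"
  proof (rule subset_Zorn_nonempty)
    show "{S. S \<subseteq> U \<and> pairwise R S} \<noteq> {}"
      using pairwise_empty[of R] by blast
  next
    fix \<C>
    assume chain: "subset.chain {S. S \<subseteq> U \<and> pairwise R S} \<C>"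
    have "R x y" if "x \<in> A" "A \<in> \<C>" "y \<in> B" "B \<in> \<C>" "x \<noteq> y" for x y A B
    proof -
      have "A \<subseteq> B \<or> B \<subseteq> A" "pairwise R A" "pairwise R B"
        using chain that unfolding subset_chain_def by blast+
      with that show ?thesis
        unfolding pairwise_def by blast
    qed
    then have "pairwise R (\<Union>\<C>)"
      unfolding pairwise_def by blast
    then show "\<Union>\<C> \<in> {S. S \<subseteq> U \<and> pairwise R S}"
      using chain unfolding subset_chain_def by blast
  qed
  then obtain S where "S \<subseteq> U" "pairwise R S"
    "\<forall>T\<in>{S. S \<subseteq> U \<and> pairwise R S}. S \<subseteq> T \<longrightarrow> T = S"
    by (elim bexE CollectE conjE)
  then show thesis
    by (intro that[of S]) auto
qed

context pre_hilbert_module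
begin

lemma ip_orthogonal_sym: "ip x y = 0 \<Longrightarrow> ip y x = 0"
  using star_ip[of x y] by (simp add: star_zero)

lemma ip_scaleC_left: "ip (c *\<^sub>C x) y = cnj c *\<^sub>C ip x y"
  by (metis ip_scaleC_right star_ip star_scaleC)

lemma module_norm_scaleC: "module_norm ip (c *\<^sub>C x) = cmod c * module_norm ip x"
proof -
  have "norm (ip (c *\<^sub>C x) (c *\<^sub>C x)) = (cmod c)\<^sup>2 * norm (ip x x)"
    by (simp add: ip_scaleC_left ip_scaleC_right norm_scaleC norm_mult power2_eq_square)
  then show ?thesis
    by (simp add: module_norm_def real_sqrt_mult)
qed

lemma module_norm_eq_0_iff: "module_norm ip x = 0 \<longleftrightarrow> x = 0"
proof -
  have "ip 0 0 = 0"
    using ip_add_right[of 0 0 0] by simp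
  then show ?thesis
    using ip_self_zero by (auto simp: module_norm_def)
qed

lemma module_norm_normalize:
  assumes "x \<noteq> 0"
  shows "module_norm ip (complex_of_real (inverse (module_norm ip x)) *\<^sub>C x) = 1"
proof -
  have "module_norm ip x \<noteq> 0" "module_norm ip x \<ge> 0"
    using assms by (simp add: module_norm_eq_0_iff, simp add: module_norm_def)
  then show ?thesis
    unfolding module_norm_scaleC norm_of_real by simp
qed

text \<open>
  The maximal set is sought among the unit vectors already orthogonal to every \<open>e i\<close>, so that the
  condition left to Zorn's lemma is pairwise. If \<open>S\<close> is maximal and \<open>y\<close> is a unit vector orthogonal
  to the whole system, then \<open>y\<close> can be adjoined to \<open>S\<close>, hence lies in \<open>S\<close>; but then \<open>y\<close> is
  orthogonal to itself, which contradicts its norm being one.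
\<close>

lemma enlarge_by_unit_vectors:
  assumes orth: "orthogonal_system ip I e"
  obtains S where
    "\<And>x. x \<in> S \<Longrightarrow> module_norm ip x = 1"
    "complete_orthogonal_system ip (Inl ` I \<union> Inr ` S) (case_sum e id)"
proof -
  define U where "U = {x. module_norm ip x = 1 \<and> (\<forall>i\<in>I. ip (e i) x = 0)}"
  obtain S where S: "S \<subseteq> U" "pairwise (\<lambda>x y. ip x y = 0) S"
    and maximal: "\<And>T. T \<subseteq> U \<Longrightarrow> pairwise (\<lambda>x y. ip x y = 0) T \<Longrightarrow> S \<subseteq> T \<Longrightarrow> T = S"
    by (rule exists_maximal_pairwise[of U "\<lambda>x y. ip x y = 0"]) (rule that)
  have eS: "ip (e i) s = 0" "ip s (e i) = 0" if "i \<in> I" "s \<in> S" for i s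
    using that S(1) by (auto simp: U_def intro: ip_orthogonal_sym)
  have "orthogonal_system ip (Inl ` I \<union> Inr ` S) (case_sum e id)"
    using orth S(2) by (auto simp: orthogonal_system_def pairwise_def eS; blast)
  moreover have False
    if x: "x \<noteq> 0" "\<forall>k\<in>Inl ` I \<union> Inr ` S. ip (case_sum e id k) x = 0" for x
  proof -
    define y where "y = complex_of_real (inverse (module_norm ip x)) *\<^sub>C x"
    have y1: "module_norm ip y = 1"
      unfolding y_def using x(1) by (rule module_norm_normalize)
    have ye: "ip (e i) y = 0" if "i \<in> I" for i
      using bspec[OF x(2), of "Inl i"] that by (auto simp: y_def ip_scaleC_right)
    have yS: "ip s y = 0" if "s \<in> S" for s
      using bspec[OF x(2), of "Inr s"] that by (auto simp: y_def ip_scaleC_right)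
    have "insert y S = S"
    proof (rule maximal)
      show "insert y S \<subseteq> U"
        using S(1) y1 ye by (auto simp: U_def)
      show "pairwise (\<lambda>x y. ip x y = 0) (insert y S)"
        using S(2) yS ip_orthogonal_sym by (auto simp: pairwise_insert)
    qed auto
    then have "ip y y = 0"
      using yS by blast
    with y1 show False
      by (simp add: module_norm_def)
  qed
  ultimately have "complete_orthogonal_system ip (Inl ` I \<union> Inr ` S) (case_sum e id)"
    unfolding complete_orthogonal_system_def by blast
  with S(1) show thesis
    by (intro that[of S]) (auto simp: U_def)
qed

end

theorem proposition2p3:
  fixes act :: "'m :: complex_vector \<Rightarrow> 'a :: cstar_algebra \<Rightarrow> 'm"
    and ip :: "'m \<Rightarrow> 'm \<Rightarrow> 'a"
  assumes "pre_hilbert_module act ip"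
  shows "(\<forall>(I :: 'i set) e. orthogonal_system ip I e \<longrightarrow>
            (\<exists>J f. enlarges_system J f I e \<and> complete_orthogonal_system ip J f)) \<and>
         (\<forall>(I :: 'i set) e. orthogonal_system ip I e \<and> (\<forall>i\<in>I. module_norm ip (e i) = 1) \<longrightarrow>
            (\<exists>J f. enlarges_system J f I e \<and> complete_orthogonal_system ip J f \<and>
                   (\<forall>j\<in>J. module_norm ip (f j) = 1)))"
proof -
  interpret pre_hilbert_module act ip
    by (rule assms)
  have "\<exists>J f. enlarges_system J f I e \<and> complete_orthogonal_system ip J f \<and>
          ((\<forall>i\<in>I. module_norm ip (e i) = 1) \<longrightarrow> (\<forall>j\<in>J. module_norm ip (f j) = 1))"
    if orth: "orthogonal_system ip I e" for I :: "'i set" and e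
  proof -
    obtain S where "\<And>x. x \<in> S \<Longrightarrow> module_norm ip x = 1"
      and "complete_orthogonal_system ip (Inl ` I \<union> Inr ` S) (case_sum e id)"
      using enlarge_by_unit_vectors[OF orth] by blast
    then show ?thesis
      by (intro exI[of _ "Inl ` I \<union> Inr ` S"] exI[of _ "case_sum e id"])
        (auto simp: enlarges_system_def)
  qed
  then show ?thesis
    by blast
qed

end
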